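(* Let $\varphi$ be a Finsler norm in $\mathbb{R}^{d}$ for which the unit ball $\{\varphi\le1\}$ is both of class $C^{1,1}$ and strictly convex. Then there is a family of convex positively one-homogeneous functions $\psi_x:\mathbb{R}^d\to[0,+\infty]$, $x\in\mathbb{R}^d\setminus\{0\}$, such that for every $x\in\mathbb{R}^d\setminus\{0\}$: (i) $\psi_x$ is (finite and) smooth in a neighborhood of $x$; (ii) $\varphi\le\psi_x$ pointwise in $\mathbb{R}^d$ and $\varphi(x)=\psi_x(x)$; (iii) $G_{*}^{\varphi}(D\psi_x(x),D^{2}\psi_x(x))=G_{\varphi}^{*}(D\psi_x(x),D^{2}\psi_x(x))=0$.
   Context: A Finsler norm in $\mathbb{R}^d$ is a convex function $\varphi:\mathbb{R}^d\to[0,+\infty)$ with $\varphi(\lambda x)=\lambda\varphi(x)$ for all $\lambda>0$ and $\varphi(x)>0$ for $x\ne0$ (no symmetry is assumed). Its dual norm is $\varphi^{*}(p)=\max\{\langle p,q\rangle : \varphi(q)\le1\}$, and $\partial\varphi^{*}$ is the subdifferential of $\varphi^{*}$. For $p\in\mathbb{R}^d$ and a symmetric $d\times d$ matrix $X$, $$G_{\varphi}^{*}(p,X)=\max\{\langle Xq,q\rangle: q\in\partial\varphi^{*}(p)\},\qquad G_{*}^{\varphi}(p,X)=\min\{\langle Xq,q\rangle: q\in\partial\varphi^{*}(p)\}.$$ A function $\psi:\mathbb{R}^d\to[0,+\infty]$ is positively one-homogeneous if $\psi(\lambda y)=\lambda\psi(y)$ for all $y\in\mathbb{R}^d$, $\lambda>0$;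 it is convex if $\{\psi<+\infty\}$ is convex and $\psi$ is convex there. $\{\varphi\le1\}$ is of class $C^{1,1}$ if it is a manifold with boundary of class $C^{1,1}$, equivalently $\varphi\in C^{1,1}_{\mathrm{loc}}(\mathbb{R}^d\setminus\{0\})$, equivalently (for this convex body) it satisfies a uniform interior ball condition: there is $\zeta>0$ such that for each $q\in\{\varphi=1\}$ there is a unit vector $e$ with $\overline{B}_\zeta(q-\zeta e)\subseteq\{\varphi\le1\}$. A convex set is strictly convex if its boundary contains no (nondegenerate) line segment. *)

theory Defs
  imports "HOL-Analysis.Analysis"
begin

definition finsler_norm :: "(real ^ 'n \<Rightarrow> real) \<Rightarrow> bool" where
  "finsler_norm \<phi> \<longleftrightarrow>
     (\<forall>x. 0 \<le> \<phi> x) \<and> convex_on UNIV \<phi> \<and>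
     (\<forall>x. \<forall>l>0. \<phi> (l *\<^sub>R x) = l * \<phi> x) \<and>
     (\<forall>x. x \<noteq> 0 \<longrightarrow> 0 < \<phi> x)"

text \<open>For a Finsler norm the supremum is over a compact nonempty set, hence is a maximum.\<close>

definition dual_norm :: "(real ^ 'n \<Rightarrow> real) \<Rightarrow> real ^ 'n \<Rightarrow> real" where
  "dual_norm \<phi> p = (SUP q\<in>{q. \<phi> q \<le> 1}. p \<bullet> q)"

definition subdifferential :: "(real ^ 'n \<Rightarrow> real) \<Rightarrow> real ^ 'n \<Rightarrow> (real ^ 'n) set" where
  "subdifferential f p = {q. \<forall>p'. f p + q \<bullet> (p' - p) \<le> f p'}"

text \<open>The subdifferential of the (finite, convex) dual norm is nonempty and compact at every
  point, so the supremum and infimum below are a maximum and a minimum.\<close>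

definition G_upper :: "(real ^ 'n \<Rightarrow> real) \<Rightarrow> real ^ 'n \<Rightarrow> real ^ 'n ^ 'n \<Rightarrow> real" where
  "G_upper \<phi> p X = (SUP q\<in>subdifferential (dual_norm \<phi>) p. (X *v q) \<bullet> q)"

definition G_lower :: "(real ^ 'n \<Rightarrow> real) \<Rightarrow> real ^ 'n \<Rightarrow> real ^ 'n ^ 'n \<Rightarrow> real" where
  "G_lower \<phi> p X = (INF q\<in>subdifferential (dual_norm \<phi>) p. (X *v q) \<bullet> q)"

definition strictly_convex :: "'a::real_normed_vector set \<Rightarrow> bool" where
  "strictly_convex S \<longleftrightarrow>
     convex S \<and> (\<forall>a b. a \<noteq> b \<longrightarrow> \<not> closed_segment a b \<subseteq> frontier S)"

text \<open>Functions with a locally Lipschitz derivative, on an open set.\<close>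

definition C11_on :: "'a::real_normed_vector set \<Rightarrow> ('a \<Rightarrow> 'b::real_normed_vector) \<Rightarrow> bool" where
  "C11_on U f \<longleftrightarrow>
     (\<exists>f' :: 'a \<Rightarrow> 'a \<Rightarrow>\<^sub>L 'b.
        (\<forall>x\<in>U. (f has_derivative blinfun_apply (f' x)) (at x)) \<and>
        (\<forall>x\<in>U. \<exists>r>0. \<exists>L. L-lipschitz_on (ball x r \<inter> U) f'))"

text \<open>Manifolds with boundary of full dimension and of class \<open>C\<^sup>1\<^sup>,\<^sup>1\<close> embedded in Euclidean
  space: locally, a \<open>C\<^sup>1\<^sup>,\<^sup>1\<close> diffeomorphism of open sets of the ambient space maps the set onto
  a relatively open piece of a closed half-space. At interior points, \<open>V\<close> may be taken inside
  the open half-space.\<close>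

definition C11_manifold_with_boundary :: "(real ^ 'n) set \<Rightarrow> bool" where
  "C11_manifold_with_boundary S \<longleftrightarrow>
     (\<forall>p\<in>S. \<exists>U V (\<Phi> :: real ^ 'n \<Rightarrow> real ^ 'n) \<Psi> k.
        open U \<and> p \<in> U \<and> open V \<and> homeomorphism U V \<Phi> \<Psi> \<and>
        C11_on U \<Phi> \<and> C11_on V \<Psi> \<and> \<Phi> ` (U \<inter> S) = V \<inter> {y. 0 \<le> y $ k})"

definition partial_deriv :: "'n \<Rightarrow> (real ^ 'n \<Rightarrow> real) \<Rightarrow> real ^ 'n \<Rightarrow> real" where
  "partial_deriv i f x = frechet_derivative f (at x) (axis i 1)"

definition gradient :: "(real ^ 'n \<Rightarrow> real) \<Rightarrow> real ^ 'n \<Rightarrow> real ^ 'n" where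
  "gradient f x = (\<chi> i. partial_deriv i f x)"

definition hessian :: "(real ^ 'n \<Rightarrow> real) \<Rightarrow> real ^ 'n \<Rightarrow> real ^ 'n ^ 'n" where
  "hessian f x = (\<chi> i j. partial_deriv i (partial_deriv j f) x)"

text \<open>The sets in \<open>Ck_on\<close> and \<open>smooth_on\<close> are meant to be open.\<close>

primrec Ck_on :: "nat \<Rightarrow> (real ^ 'n) set \<Rightarrow> (real ^ 'n \<Rightarrow> real) \<Rightarrow> bool" where
  "Ck_on 0 U f \<longleftrightarrow> continuous_on U f"
| "Ck_on (Suc k) U f \<longleftrightarrow>
     (\<forall>x\<in>U. f differentiable (at x)) \<and> (\<forall>i. Ck_on k U (partial_deriv i f))"

definition smooth_on :: "(real ^ 'n) set \<Rightarrow> (real ^ 'n \<Rightarrow> real) \<Rightarrow> bool" where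
  "smooth_on U f \<longleftrightarrow> (\<forall>k. Ck_on k U f)"

definition pos_one_homogeneous :: "(real ^ 'n \<Rightarrow> ennreal) \<Rightarrow> bool" where
  "pos_one_homogeneous \<psi> \<longleftrightarrow> (\<forall>y. \<forall>l>0. \<psi> (l *\<^sub>R y) = ennreal l * \<psi> y)"

definition convex_extended :: "(real ^ 'n \<Rightarrow> ennreal) \<Rightarrow> bool" where
  "convex_extended \<psi> \<longleftrightarrow>
     convex {y. \<psi> y < \<infinity>} \<and> convex_on {y. \<psi> y < \<infinity>} (\<lambda>y. enn2real (\<psi> y))"

end

theory Submission
  imports Defs
begin

text \<open>Normalise \<open>q = x / \<phi>(x)\<close>, so that \<open>\<phi>(q) = 1\<close>, and let \<open>p\<close> be the normal of the unit ball at
  \<open>q\<close>, scaled so that \<open>p \<bullet> q = 1\<close>; then \<open>p \<bullet> z \<le> \<phi>(z)\<close> everywhere. Regularity of class \<open>C\<^sup>1\<^sup>,\<^sup>1\<close>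
  says that \<open>\<phi>\<close> stays below a paraboloid on the supporting hyperplane \<open>p \<bullet> z = 1\<close>, that is,
  \<open>\<phi>(z) \<le> 1 + C |z - q|\<^sup>2\<close> (\<open>finsler_quadratic_contact\<close>). The function \<open>\<psi>\<^sub>x\<close> is the one-homogeneous
  extension of this paraboloid to the half-space \<open>p \<bullet> y > 0\<close>,
  \[ \psi_x(y) = p \cdot y + C\,\frac{|y - (p \cdot y)\,q|^2}{p \cdot y}, \]
  and infinity outside it. It is the perspective of a convex function, hence convex; it is rational
  on the half-space, hence smooth; and by homogeneity it lies above \<open>\<phi>\<close>, with equality on the ray
  through \<open>q\<close>.

  For the curvature condition, the gradient of \<open>\<psi>\<^sub>x\<close> at \<open>x\<close> is \<open>p\<close>, because the quadratic term
  vanishes to second order on the ray. The elements of the subdifferential of the dual norm at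
  \<open>p\<close> are the points of the unit ball at which \<open>p\<close> attains its maximum; they form a convex subset of
  the unit sphere, which by strict convexity is the single point \<open>q\<close>
  (\<open>subdifferential_dual_norm_eq\<close>). So both \<open>G_lower\<close> and \<open>G_upper\<close> are the value at \<open>q\<close> of the
  quadratic form of the Hessian, and the Hessian at \<open>x\<close> annihilates the radial direction \<open>q\<close>
  (\<open>hessian_paraboloid_gauge_radial\<close>).\<close>

section \<open>Smooth functions\<close>

lemma partial_deriv_eqI:
  "(f has_derivative D) (at x) \<Longrightarrow> partial_deriv i f x = D (axis i 1)"
  unfolding partial_deriv_def by (metis frechet_derivative_at)

lemma has_derivative_cong_open:
  assumes "open U" "x \<in> U" "\<And>y. y \<in> U \<Longrightarrow> f y = g y"
  shows "(f has_derivative D) (at x) \<longleftrightarrow> (g has_derivative D) (at x)"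
proof
  show "(g has_derivative D) (at x)" if "(f has_derivative D) (at x)"
    by (rule has_derivative_transform_within_open[OF that assms])
  show "(f has_derivative D) (at x)" if "(g has_derivative D) (at x)"
    by (rule has_derivative_transform_within_open[OF that assms(1,2)]) (simp add: assms(3))
qed

lemma partial_deriv_cong_open:
  assumes "open U" "x \<in> U" "\<And>y. y \<in> U \<Longrightarrow> f y = g y"
  shows "partial_deriv i f x = partial_deriv i g x"
  unfolding partial_deriv_def frechet_derivative_def
  by (simp add: has_derivative_cong_open[OF assms])

text \<open>Derivatives are known in closed form only on a given open set, whereas \<open>partial_deriv\<close> is a total
  function; differentiability classes are insensitive to values off the open set.\<close>

lemma Ck_on_cong_open:
  assumes "open U" "\<And>y. y \<in> U \<Longrightarrow> f y = g y"
  shows "Ck_on k U f \<longleftrightarrow> Ck_on k U g"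
  using assms(2)
proof (induction k arbitrary: f g)
  case 0
  then show ?case by (auto cong: continuous_on_cong)
next
  case (Suc k)
  have "f differentiable (at x) \<longleftrightarrow> g differentiable (at x)" if "x \<in> U" for x
    unfolding differentiable_def
    by (simp add: has_derivative_cong_open[OF assms(1) that Suc.prems])
  moreover have "Ck_on k U (partial_deriv i f) \<longleftrightarrow> Ck_on k U (partial_deriv i g)" for i
    by (rule Suc.IH, rule partial_deriv_cong_open) (use Suc.prems assms(1) in auto)
  ultimately show ?case by simp
qed

lemma Ck_on_SucI:
  assumes "open U" "\<And>x. x \<in> U \<Longrightarrow> (f has_derivative D x) (at x)"
    and "\<And>i. Ck_on k U (\<lambda>x. D x (axis i 1))"
  shows "Ck_on (Suc k) U f"
proof -
  have "Ck_on k U (partial_deriv i f)" for i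
    using Ck_on_cong_open[OF assms(1), of "partial_deriv i f" "\<lambda>x. D x (axis i 1)"]
      assms(2,3) partial_deriv_eqI by blast
  then show ?thesis using assms(2) by (auto simp: differentiable_def)
qed

lemma Ck_on_SucD: "Ck_on (Suc k) U f \<Longrightarrow> Ck_on k U f"
proof (induction k arbitrary: f)
  case 0
  then show ?case
    by (auto intro!: continuous_at_imp_continuous_on differentiable_imp_continuous_within)
next
  case (Suc k)
  then show ?case by (metis Ck_on.simps(2))
qed

lemma Ck_on_const:
  assumes "open U"
  shows "Ck_on k U (\<lambda>_. c)"
proof (induction k arbitrary: c)
  case (Suc k)
  show ?case
    by (rule Ck_on_SucI[OF assms has_derivative_const Suc.IH])
qed simp

lemma Ck_on_bounded_linear:
  assumes "open U" "bounded_linear f"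
  shows "Ck_on k U f"
proof (cases k)
  case 0
  then show ?thesis using assms(2) by (simp add: linear_continuous_on)
next
  case (Suc j)
  then show ?thesis
    using Ck_on_SucI[OF assms(1), of f "\<lambda>_. f"] Ck_on_const[OF assms(1)]
      bounded_linear_imp_has_derivative[OF assms(2)] by blast
qed

lemma Ck_on_add:
  assumes "open U" "Ck_on k U f" "Ck_on k U g"
  shows "Ck_on k U (\<lambda>x. f x + g x)"
  using assms(2,3)
proof (induction k arbitrary: f g)
  case 0
  then show ?case by (auto intro: continuous_intros)
next
  case (Suc k)
  let ?F = "\<lambda>h x. frechet_derivative h (at x)"
  have F: "(h has_derivative ?F h x) (at x)" if "Ck_on (Suc k) U h" "x \<in> U" for h x
    using that by (simp add: frechet_derivative_works)
  show ?case
  proof (rule Ck_on_SucI[OF assms(1)])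
    show "((\<lambda>x. f x + g x) has_derivative (\<lambda>h. ?F f x h + ?F g x h)) (at x)" if "x \<in> U" for x
      using F[OF Suc.prems(1) that] F[OF Suc.prems(2) that] by (rule has_derivative_add)
    show "Ck_on k U (\<lambda>x. ?F f x (axis i 1) + ?F g x (axis i 1))" for i
      using Suc.IH[of "partial_deriv i f" "partial_deriv i g"] Suc.prems
      by (simp add: partial_deriv_def[abs_def])
  qed
qed

text \<open>The product rule involves \<open>f\<close> and \<open>g\<close> themselves next to their derivatives, so the induction
  hypothesis is applied to functions of class one lower, by \<open>Ck_on_SucD\<close>.\<close>

lemma Ck_on_mult:
  assumes "open U" "Ck_on k U f" "Ck_on k U g"
  shows "Ck_on k U (\<lambda>x. f x * g x)"
  using assms(2,3)
proof (induction k arbitrary: f g)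
  case 0
  then show ?case by (auto intro: continuous_intros)
next
  case (Suc k)
  let ?F = "\<lambda>h x. frechet_derivative h (at x)"
  have F: "(h has_derivative ?F h x) (at x)" if "Ck_on (Suc k) U h" "x \<in> U" for h x
    using that by (simp add: frechet_derivative_works)
  show ?case
  proof (rule Ck_on_SucI[OF assms(1)])
    show "((\<lambda>x. f x * g x) has_derivative (\<lambda>h. f x * ?F g x h + ?F f x h * g x)) (at x)"
      if "x \<in> U" for x
      using F[OF Suc.prems(1) that] F[OF Suc.prems(2) that] by (rule has_derivative_mult)
    show "Ck_on k U (\<lambda>x. f x * ?F g x (axis i 1) + ?F f x (axis i 1) * g x)" for i
      using Suc.IH[of f "partial_deriv i g"] Suc.IH[of "partial_deriv i f" g]
        Suc.prems Ck_on_SucD[OF Suc.prems(1)] Ck_on_SucD[OF Suc.prems(2)]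
      by (intro Ck_on_add assms(1)) (simp_all add: partial_deriv_def[abs_def])
  qed
qed

lemma Ck_on_inverse:
  assumes "open U" "Ck_on k U f" "\<And>x. x \<in> U \<Longrightarrow> f x \<noteq> 0"
  shows "Ck_on k U (\<lambda>x. inverse (f x))"
  using assms(2)
proof (induction k)
  case 0
  then show ?case using assms(3) by (auto intro: continuous_intros)
next
  case (Suc k)
  let ?F = "\<lambda>x. frechet_derivative f (at x)"
  have inv: "Ck_on k U (\<lambda>x. inverse (f x))"
    by (rule Suc.IH[OF Ck_on_SucD[OF Suc.prems]])
  show ?case
  proof (rule Ck_on_SucI[OF assms(1)])
    show "((\<lambda>x. inverse (f x)) has_derivative
        (\<lambda>h. (-1) * (inverse (f x) * ?F x h * inverse (f x)))) (at x)" if "x \<in> U" for x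
      using Deriv.has_derivative_inverse[of "f" x "?F x" UNIV] assms(3)[OF that] that Suc.prems
      by (simp add: frechet_derivative_works)
    have "Ck_on k U (partial_deriv i f)" for i using Suc.prems by simp
    then show "Ck_on k U (\<lambda>x. (-1) * (inverse (f x) * ?F x (axis i 1) * inverse (f x)))" for i
      by (intro Ck_on_mult Ck_on_const assms(1) inv) (simp add: partial_deriv_def[abs_def])
  qed
qed

lemma Ck_on_sum:
  assumes "open U" "\<And>i. i \<in> I \<Longrightarrow> Ck_on k U (f i)"
  shows "Ck_on k U (\<lambda>x. \<Sum>i\<in>I. f i x)"
  using assms(2)
proof (induction I rule: infinite_finite_induct)
  case (insert i I)
  then show ?case using Ck_on_add[OF assms(1), of k "f i" "\<lambda>x. \<Sum>i\<in>I. f i x"] by simp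
qed (simp_all add: Ck_on_const[OF assms(1)])

section \<open>The paraboloid model\<close>

text \<open>When \<open>p \<bullet> q = 1\<close> this is the projection onto the hyperplane \<open>p \<bullet> h = 0\<close> along \<open>q\<close>.\<close>

definition transverse :: "real ^ 'n \<Rightarrow> real ^ 'n \<Rightarrow> real ^ 'n \<Rightarrow> real ^ 'n" where
  "transverse p q y = y - (p \<bullet> y) *\<^sub>R q"

text \<open>On \<open>p \<bullet> y > 0\<close> this is the perspective \<open>(p \<bullet> y) * h(y / (p \<bullet> y))\<close> of \<open>h(z) = 1 + C |z - q|\<^sup>2\<close>, a
  function on the hyperplane \<open>p \<bullet> z = 1\<close>.\<close>

definition paraboloid_gauge :: "real ^ 'n \<Rightarrow> real ^ 'n \<Rightarrow> real \<Rightarrow> real ^ 'n \<Rightarrow> real" where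
  "paraboloid_gauge p q C y = p \<bullet> y + C * ((norm (transverse p q y))\<^sup>2 / (p \<bullet> y))"

lemma bounded_linear_transverse: "bounded_linear (transverse p q)"
  unfolding transverse_def[abs_def]
  by (intro bounded_linear_sub bounded_linear_ident
      bounded_linear_compose[OF bounded_linear_scaleR_left bounded_linear_inner_right])

lemma transverse_ray: "p \<bullet> q = 1 \<Longrightarrow> transverse p q (k *\<^sub>R q) = 0"
  by (simp add: transverse_def)

lemma paraboloid_gauge_homogeneous:
  assumes "l > 0"
  shows "paraboloid_gauge p q C (l *\<^sub>R y) = l * paraboloid_gauge p q C y"
proof -
  have "transverse p q (l *\<^sub>R y) = l *\<^sub>R transverse p q y"
    by (rule linear_cmul) (simp add: bounded_linear_transverse bounded_linear.linear)
  then show ?thesis using assms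
    by (simp add: paraboloid_gauge_def power_mult_distrib field_simps power2_eq_square)
qed

text \<open>The convexity gap, multiplied by the denominator of the left-hand side, is a multiple of the square
  \<open>|v w - u z|\<^sup>2\<close>.\<close>

lemma sq_norm_over_linear_convex:
  fixes w z :: "'a::real_inner"
  assumes "u > 0" "v > 0" "0 \<le> s" "0 \<le> t" "s + t = 1"
  shows "(norm (s *\<^sub>R w + t *\<^sub>R z))\<^sup>2 / (s * u + t * v)
       \<le> s * ((norm w)\<^sup>2 / u) + t * ((norm z)\<^sup>2 / v)"
proof -
  have pos: "s * u + t * v > 0"
    by (smt (verit) assms mult_nonneg_nonneg mult_pos_pos)
  have "(s * ((norm w)\<^sup>2 / u) + t * ((norm z)\<^sup>2 / v)) * (s * u + t * v)
        - (norm (s *\<^sub>R w + t *\<^sub>R z))\<^sup>2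
      = s * t * (norm (v *\<^sub>R w - u *\<^sub>R z))\<^sup>2 / (u * v)"
    unfolding power2_norm_eq_inner
    using assms(1,2) by (simp add: inner_add inner_diff inner_commute field_simps)
  also have "\<dots> \<ge> 0" using assms by simp
  finally show ?thesis using pos by (simp add: pos_divide_le_eq)
qed

lemma paraboloid_gauge_convex:
  assumes "C \<ge> 0"
  shows "convex_on {y. 0 < p \<bullet> y} (paraboloid_gauge p q C)"
proof (rule convex_onI)
  show "convex {y. 0 < p \<bullet> y}" using convex_halfspace_gt[of 0 p] by simp
next
  fix t x y
  assume t: "0 < t" "t < (1::real)" and xy: "x \<in> {y. 0 < p \<bullet> y}" "y \<in> {y. 0 < p \<bullet> y}"
  have lin: "linear (transverse p q)"
    by (simp add: bounded_linear_transverse bounded_linear.linear)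
  have "transverse p q ((1 - t) *\<^sub>R x + t *\<^sub>R y)
      = (1 - t) *\<^sub>R transverse p q x + t *\<^sub>R transverse p q y"
    using lin by (simp add: linear_add linear_cmul)
  then have "(norm (transverse p q ((1 - t) *\<^sub>R x + t *\<^sub>R y)))\<^sup>2 / (p \<bullet> ((1 - t) *\<^sub>R x + t *\<^sub>R y))
      \<le> (1 - t) * ((norm (transverse p q x))\<^sup>2 / (p \<bullet> x))
        + t * ((norm (transverse p q y))\<^sup>2 / (p \<bullet> y))"
    using sq_norm_over_linear_convex[of "p \<bullet> x" "p \<bullet> y" "1 - t" t] t xy
    by (simp add: inner_add_right)
  from mult_left_mono[OF this assms]
  show "paraboloid_gauge p q C ((1 - t) *\<^sub>R x + t *\<^sub>R y)
      \<le> (1 - t) * paraboloid_gauge p q C x + t * paraboloid_gauge p q C y"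
    by (simp add: paraboloid_gauge_def inner_add_right algebra_simps)
qed

lemma paraboloid_gauge_smooth: "smooth_on {y. 0 < p \<bullet> y} (paraboloid_gauge p q C)"
  unfolding smooth_on_def
proof
  fix k
  let ?H = "{y. 0 < p \<bullet> y}"
  have H: "open ?H" using open_halfspace_gt[of 0 p] by simp
  have p: "Ck_on k ?H (\<lambda>y. p \<bullet> y)"
    by (intro Ck_on_bounded_linear H bounded_linear_inner_right)
  have tr: "Ck_on k ?H (\<lambda>y. transverse p q y $ i)" for i
    by (intro Ck_on_bounded_linear H
        bounded_linear_compose[OF bounded_linear_vec_nth bounded_linear_transverse])
  have eq: "paraboloid_gauge p q C = (\<lambda>y. p \<bullet> y +
      C * ((\<Sum>i\<in>UNIV. transverse p q y $ i * transverse p q y $ i) * inverse (p \<bullet> y)))"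
    by (simp add: paraboloid_gauge_def power2_norm_eq_inner inner_vec_def divide_inverse fun_eq_iff)
  show "Ck_on k ?H (paraboloid_gauge p q C)"
    unfolding eq
    by (intro Ck_on_add Ck_on_mult Ck_on_const Ck_on_sum Ck_on_inverse p tr H) simp
qed

lemma has_derivative_transverse: "(transverse p q has_derivative transverse p q) (at y)"
  by (rule bounded_linear_imp_has_derivative[OF bounded_linear_transverse])

lemma has_derivative_inner_const: "((\<lambda>y. p \<bullet> y) has_derivative (\<lambda>h. p \<bullet> h)) (at y)"
  by (rule bounded_linear_imp_has_derivative[OF bounded_linear_inner_right])

lemma has_derivative_sq_norm_transverse_over:
  assumes "0 < p \<bullet> y"
  shows "((\<lambda>y. (norm (transverse p q y))\<^sup>2 / (p \<bullet> y)) has_derivative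
     (\<lambda>h. 2 * (transverse p q y \<bullet> transverse p q h) / (p \<bullet> y)
        - (norm (transverse p q y))\<^sup>2 * (p \<bullet> h) / (p \<bullet> y)\<^sup>2)) (at y)"
  unfolding power2_norm_eq_inner
  by (rule has_derivative_eq_rhs, rule has_derivative_divide',
      rule has_derivative_inner[OF has_derivative_transverse has_derivative_transverse],
      rule has_derivative_inner_const)
    (use assms in \<open>simp_all add: fun_eq_iff inner_commute field_simps power2_eq_square\<close>)

lemma paraboloid_gauge_has_derivative:
  assumes "0 < p \<bullet> y"
  shows "(paraboloid_gauge p q C has_derivative
     (\<lambda>h. p \<bullet> h + C * (2 * (transverse p q y \<bullet> transverse p q h) / (p \<bullet> y)
        - (norm (transverse p q y))\<^sup>2 * (p \<bullet> h) / (p \<bullet> y)\<^sup>2))) (at y)"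
  unfolding paraboloid_gauge_def[abs_def]
  by (intro has_derivative_add has_derivative_inner_const has_derivative_mult_right
      has_derivative_sq_norm_transverse_over assms)

lemma partial_deriv_paraboloid_gauge:
  "0 < p \<bullet> y \<Longrightarrow> partial_deriv j (paraboloid_gauge p q C) y =
     p $ j + C * (2 * (transverse p q y \<bullet> transverse p q (axis j 1)) / (p \<bullet> y)
        - (norm (transverse p q y))\<^sup>2 * p $ j / (p \<bullet> y)\<^sup>2)"
  using partial_deriv_eqI[OF paraboloid_gauge_has_derivative] by (simp add: inner_axis)

lemma gradient_paraboloid_gauge:
  assumes "p \<bullet> q = 1" "k > 0"
  shows "gradient (paraboloid_gauge p q C) (k *\<^sub>R q) = p"
  using assms
  by (simp add: gradient_def vec_eq_iff partial_deriv_paraboloid_gauge transverse_ray)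

text \<open>The transverse part vanishes along the ray, so only the terms in which both factors of
  \<open>|y - (p \<bullet> y) q|\<^sup>2\<close> are differentiated survive: the Hessian is a Gram matrix of projected basis
  vectors.\<close>

lemma hessian_paraboloid_gauge:
  assumes "p \<bullet> q = 1" "k > 0"
  shows "hessian (paraboloid_gauge p q C) (k *\<^sub>R q) $ i $ j
    = 2 * C / k * (transverse p q (axis i 1) \<bullet> transverse p q (axis j 1))"
proof -
  let ?H = "{y. 0 < p \<bullet> y}" and ?T = "transverse p q"
  let ?g = "\<lambda>y. p $ j + C * (2 * (?T y \<bullet> ?T (axis j 1)) / (p \<bullet> y)
        - (?T y \<bullet> ?T y) * p $ j / (p \<bullet> y)\<^sup>2)"
  have T0: "?T (k *\<^sub>R q) = 0" using assms(1) by (rule transverse_ray)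
  have py: "p \<bullet> (k *\<^sub>R q) = k" using assms(1) by simp
  have "open ?H" using open_halfspace_gt[of 0 p] by simp
  moreover have "k *\<^sub>R q \<in> ?H" using assms by simp
  ultimately have "partial_deriv i (partial_deriv j (paraboloid_gauge p q C)) (k *\<^sub>R q)
      = partial_deriv i ?g (k *\<^sub>R q)"
    by (rule partial_deriv_cong_open)
      (simp add: partial_deriv_paraboloid_gauge power2_norm_eq_inner)
  also have "\<dots> = 2 * C / k * (?T (axis i 1) \<bullet> ?T (axis j 1))"
  proof (rule partial_deriv_eqI)
    have lin: "((\<lambda>y. 2 * (?T y \<bullet> ?T (axis j 1)) / (p \<bullet> y)) has_derivative
        (\<lambda>h. 2 / k * (?T h \<bullet> ?T (axis j 1)))) (at (k *\<^sub>R q))"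
      by (rule has_derivative_eq_rhs, rule has_derivative_divide',
          rule has_derivative_mult_right[OF has_derivative_inner_left[OF has_derivative_transverse]],
          rule has_derivative_inner_const)
        (use assms in \<open>simp_all add: py T0 fun_eq_iff field_simps\<close>)
    have quad: "((\<lambda>y. (?T y \<bullet> ?T y) * p $ j / (p \<bullet> y)\<^sup>2) has_derivative (\<lambda>h. 0)) (at (k *\<^sub>R q))"
      by (rule has_derivative_eq_rhs, rule has_derivative_divide',
          rule has_derivative_mult_left[OF
            has_derivative_inner[OF has_derivative_transverse has_derivative_transverse]],
          rule has_derivative_power[OF has_derivative_inner_const])
        (use assms in \<open>simp_all add: py T0 fun_eq_iff\<close>)
    have "(?g has_derivative
        (\<lambda>h. 0 + C * (2 / k * (?T h \<bullet> ?T (axis j 1)) - 0))) (at (k *\<^sub>R q))"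
      by (intro has_derivative_add has_derivative_const has_derivative_mult_right
          has_derivative_diff lin quad)
    then show "(?g has_derivative (\<lambda>h. 2 * C / k * (?T h \<bullet> ?T (axis j 1)))) (at (k *\<^sub>R q))"
      by (simp add: mult_ac)
  qed
  finally show ?thesis by (simp add: hessian_def)
qed

text \<open>Contracting the Gram matrix with \<open>q\<close> produces the projection of \<open>q\<close>, which is zero. This is Euler's
  identity for the gradient, which is homogeneous of degree zero.\<close>

lemma hessian_paraboloid_gauge_radial:
  assumes "p \<bullet> q = 1" "k > 0"
  shows "hessian (paraboloid_gauge p q C) (k *\<^sub>R q) *v q = 0"
proof -
  let ?T = "transverse p q"
  have lin: "linear ?T" by (simp add: bounded_linear_transverse bounded_linear.linear)
  have "?T q = ?T (\<Sum>j\<in>UNIV. q $ j *\<^sub>R axis j 1)"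
    using basis_expansion[of q] by (simp add: scalar_mult_eq_scaleR)
  also have "\<dots> = (\<Sum>j\<in>UNIV. q $ j *\<^sub>R ?T (axis j 1))"
    using lin by (simp add: linear_sum linear_cmul)
  finally have "(\<Sum>j\<in>UNIV. q $ j *\<^sub>R ?T (axis j 1)) = 0"
    using transverse_ray[OF assms(1), of 1] by simp
  then have "?T (axis i 1) \<bullet> (\<Sum>j\<in>UNIV. q $ j *\<^sub>R ?T (axis j 1)) = 0" for i by simp
  then have 0: "(\<Sum>j\<in>UNIV. q $ j * (?T (axis i 1) \<bullet> ?T (axis j 1))) = 0" for i
    by (simp add: inner_sum_right)
  have "(hessian (paraboloid_gauge p q C) (k *\<^sub>R q) *v q) $ i = 0" for i
  proof -
    have "(hessian (paraboloid_gauge p q C) (k *\<^sub>R q) *v q) $ i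
        = (\<Sum>j\<in>UNIV. 2 * C / k * (q $ j * (?T (axis i 1) \<bullet> ?T (axis j 1))))"
      by (simp add: matrix_vector_mult_def hessian_paraboloid_gauge[OF assms] mult_ac)
    also have "\<dots> = 2 * C / k * 0"
      by (simp only: sum_distrib_left[symmetric] 0)
    finally show ?thesis by simp
  qed
  then show ?thesis by (simp add: vec_eq_iff)
qed

section \<open>Finsler norms\<close>

lemma finsler_scale: "finsler_norm \<phi> \<Longrightarrow> l > 0 \<Longrightarrow> \<phi> (l *\<^sub>R x) = l * \<phi> x"
  by (simp add: finsler_norm_def)

lemma finsler_pos: "finsler_norm \<phi> \<Longrightarrow> x \<noteq> 0 \<Longrightarrow> 0 < \<phi> x"
  by (simp add: finsler_norm_def)

lemma finsler_zero: "finsler_norm \<phi> \<Longrightarrow> \<phi> 0 = 0"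
  using finsler_scale[of \<phi> 2 0] by simp

lemma finsler_add_le:
  assumes "finsler_norm \<phi>"
  shows "\<phi> (x + y) \<le> \<phi> x + \<phi> y"
proof -
  have "convex_on UNIV \<phi>" using assms by (simp add: finsler_norm_def)
  from convex_onD[OF this, of "1/2" x y]
  have "\<phi> ((1/2) *\<^sub>R (x + y)) \<le> (\<phi> x + \<phi> y) / 2" by (simp add: scaleR_add_right)
  then show ?thesis using finsler_scale[OF assms, of "1/2" "x + y"] by simp
qed

lemma finsler_continuous: "finsler_norm \<phi> \<Longrightarrow> continuous_on UNIV \<phi>"
  by (intro convex_on_continuous) (simp_all add: finsler_norm_def)

lemma finsler_unit_ball_closed: "finsler_norm \<phi> \<Longrightarrow> closed {x. \<phi> x \<le> 1}"
  by (intro closed_Collect_le finsler_continuous continuous_on_const)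

lemma finsler_unit_ball_convex:
  assumes "finsler_norm \<phi>"
  shows "convex {x. \<phi> x \<le> 1}"
proof (rule convexI)
  fix x y and u v :: real
  assume xy: "x \<in> {x. \<phi> x \<le> 1}" "y \<in> {x. \<phi> x \<le> 1}" and uv: "0 \<le> u" "0 \<le> v" "u + v = 1"
  have "convex_on UNIV \<phi>" using assms by (simp add: finsler_norm_def)
  then have "\<phi> (u *\<^sub>R x + v *\<^sub>R y) \<le> u * \<phi> x + v * \<phi> y"
    using uv by (simp add: convex_on_def)
  also have "\<dots> \<le> 1" using xy uv by (intro convex_bound_le) auto
  finally show "u *\<^sub>R x + v *\<^sub>R y \<in> {x. \<phi> x \<le> 1}" by simp
qed

text \<open>Without symmetry \<open>\<phi>\<close> is still comparable to the Euclidean norm: it is continuous and positive on the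
  compact unit sphere.\<close>

lemma finsler_norm_equiv:
  assumes "finsler_norm \<phi>"
  obtains m M where "m > 0" "M > 0" "\<And>x. m * norm x \<le> \<phi> x" "\<And>x. \<phi> x \<le> M * norm x"
proof -
  let ?S = "sphere (0 :: real ^ 'n) 1"
  have S: "compact ?S" "?S \<noteq> {}" by auto
  have c: "continuous_on ?S \<phi>"
    using finsler_continuous[OF assms] continuous_on_subset by blast
  obtain a where a: "a \<in> ?S" "\<And>y. y \<in> ?S \<Longrightarrow> \<phi> a \<le> \<phi> y"
    using continuous_attains_inf[OF S c] by blast
  obtain b where b: "b \<in> ?S" "\<And>y. y \<in> ?S \<Longrightarrow> \<phi> y \<le> \<phi> b"
    using continuous_attains_sup[OF S c] by blast
  have "\<phi> a * norm x \<le> \<phi> x \<and> \<phi> x \<le> \<phi> b * norm x" for x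
  proof (cases "x = 0")
    case False
    then have x: "(1 / norm x) *\<^sub>R x \<in> ?S" by simp
    have "\<phi> x = norm x * \<phi> ((1 / norm x) *\<^sub>R x)"
      using False finsler_scale[OF assms, of "1 / norm x" x] by simp
    then show ?thesis
      using a(2)[OF x] b(2)[OF x] by (simp add: mult.commute mult_left_mono)
  qed (simp add: finsler_zero[OF assms])
  moreover have "a \<noteq> 0" "b \<noteq> 0" using a(1) b(1) by auto
  then have "\<phi> a > 0" "\<phi> b > 0" using finsler_pos[OF assms] by auto
  ultimately show thesis using that by blast
qed

lemma finsler_unit_sphere_frontier:
  assumes "finsler_norm \<phi>" "\<phi> x = 1"
  shows "x \<in> frontier {x. \<phi> x \<le> 1}"
proof -
  have x0: "x \<noteq> 0" using assms finsler_zero by force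
  have "x \<notin> interior {x. \<phi> x \<le> 1}"
  proof
    assume "x \<in> interior {x. \<phi> x \<le> 1}"
    then obtain e where e: "e > 0" "ball x e \<subseteq> {x. \<phi> x \<le> 1}"
      by (meson mem_interior)
    define t where "t = e / (2 * norm x)"
    have t: "t > 0" using e x0 by (simp add: t_def)
    have "dist x ((1 + t) *\<^sub>R x) = t * norm x"
      using t by (simp add: dist_norm algebra_simps)
    also have "\<dots> < e" using e x0 by (simp add: t_def)
    finally have "\<phi> ((1 + t) *\<^sub>R x) \<le> 1" using e(2) by auto
    then show False using finsler_scale[OF assms(1), of "1 + t" x] t assms(2) by simp
  qed
  then show ?thesis
    using assms(2) closure_subset[of "{x. \<phi> x \<le> 1}"] by (auto simp: frontier_def)
qed

lemma dual_norm_bdd_above: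
  assumes "finsler_norm \<phi>"
  shows "bdd_above ((\<lambda>q. p \<bullet> q) ` {q. \<phi> q \<le> 1})"
proof -
  obtain m M where m: "m > 0" "\<And>x. m * norm x \<le> \<phi> x"
    using finsler_norm_equiv[OF assms] by metis
  have "p \<bullet> q \<le> norm p * (1 / m)" if "\<phi> q \<le> 1" for q
  proof -
    have "norm q \<le> 1 / m" using m(1) m(2)[of q] that by (simp add: field_simps)
    then show ?thesis
      by (meson norm_cauchy_schwarz mult_left_mono norm_ge_zero order_trans)
  qed
  then show ?thesis by (intro bdd_aboveI2) auto
qed

lemma inner_le_dual_norm:
  "finsler_norm \<phi> \<Longrightarrow> \<phi> q \<le> 1 \<Longrightarrow> p \<bullet> q \<le> dual_norm \<phi> p"
  unfolding dual_norm_def by (rule cSUP_upper[OF _ dual_norm_bdd_above]) auto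

lemma dual_norm_le:
  assumes "finsler_norm \<phi>" "\<And>q. \<phi> q \<le> 1 \<Longrightarrow> p \<bullet> q \<le> c"
  shows "dual_norm \<phi> p \<le> c"
  unfolding dual_norm_def
  using assms finsler_zero[OF assms(1)] by (intro cSUP_least) (auto intro!: exI[of _ 0])

text \<open>Bipolarity for the unit ball: a point outside this closed convex set is strictly separated from it
  by some linear functional.\<close>

lemma finsler_le_1_if_dual:
  assumes "finsler_norm \<phi>" "\<And>p. p \<bullet> q \<le> dual_norm \<phi> p"
  shows "\<phi> q \<le> 1"
proof (rule ccontr)
  assume "\<not> \<phi> q \<le> 1"
  then obtain a b where ab: "a \<bullet> q < b" "\<And>z. \<phi> z \<le> 1 \<Longrightarrow> b < a \<bullet> z"
    using separating_hyperplane_closed_point[OF finsler_unit_ball_convex[OF assms(1)]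
        finsler_unit_ball_closed[OF assms(1)], of q] by auto
  have "dual_norm \<phi> (- a) \<le> - b"
    by (rule dual_norm_le[OF assms(1)]) (use ab(2) in force)
  then show False using assms(2)[of "- a"] ab(1) by simp
qed

text \<open>Testing a subgradient \<open>w\<close> at \<open>0\<close> and \<open>2 p\<close> gives \<open>w \<bullet> p = 1\<close>, after which the subgradient
  inequality reads \<open>w \<bullet> p' \<le> dual_norm \<phi> p'\<close>, so \<open>w\<close> lies in the unit ball. The segment from \<open>w\<close>
  to \<open>q\<close> then lies both in the ball and in the supporting hyperplane, hence in the frontier, and
  strict convexity collapses it.\<close>

lemma subdifferential_dual_norm_eq:
  assumes fin: "finsler_norm \<phi>" and sc: "strictly_convex {x. \<phi> x \<le> 1}"
    and q: "\<phi> q = 1" "p \<bullet> q = 1" and supp: "\<And>z. p \<bullet> z \<le> \<phi> z"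
  shows "subdifferential (dual_norm \<phi>) p = {q}"
proof -
  have dn: "dual_norm \<phi> p = 1"
  proof (rule antisym)
    show "dual_norm \<phi> p \<le> 1"
      by (rule dual_norm_le[OF fin]) (rule order_trans[OF supp])
    show "1 \<le> dual_norm \<phi> p" using inner_le_dual_norm[OF fin, of q p] q by simp
  qed
  have "q \<in> subdifferential (dual_norm \<phi>) p"
    using inner_le_dual_norm[OF fin, of q] q
    by (simp add: subdifferential_def dn inner_diff_right inner_commute)
  moreover have "w = q" if "w \<in> subdifferential (dual_norm \<phi>) p" for w
  proof -
    have w: "1 + w \<bullet> (p' - p) \<le> dual_norm \<phi> p'" for p'
      using that by (simp add: subdifferential_def dn)
    have "dual_norm \<phi> 0 \<le> 0" by (rule dual_norm_le[OF fin]) simp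
    with w[of 0] have ge: "1 \<le> w \<bullet> p" by simp
    have "dual_norm \<phi> (2 *\<^sub>R p) \<le> 2"
    proof (rule dual_norm_le[OF fin])
      show "2 *\<^sub>R p \<bullet> z \<le> 2" if "\<phi> z \<le> 1" for z
        using supp[of z] that by simp
    qed
    with w[of "2 *\<^sub>R p"] have "w \<bullet> p \<le> 1" by (simp add: scaleR_2)
    with ge have wp: "w \<bullet> p = 1" by simp
    have "\<phi> w \<le> 1"
      by (rule finsler_le_1_if_dual[OF fin])
        (use w wp in \<open>simp add: inner_diff_right inner_commute\<close>)
    have "closed_segment w q \<subseteq> frontier {x. \<phi> x \<le> 1}"
    proof
      fix z assume z: "z \<in> closed_segment w q"
      have "w \<in> {x. \<phi> x \<le> 1}" "q \<in> {x. \<phi> x \<le> 1}" using \<open>\<phi> w \<le> 1\<close> q by auto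
      then have "z \<in> {x. \<phi> x \<le> 1}"
        using closed_segment_subset[OF _ _ finsler_unit_ball_convex[OF fin]] z by blast
      moreover have "p \<bullet> z = 1"
        using z wp q by (auto simp: in_segment inner_add_right inner_commute)
      ultimately have "\<phi> z = 1" using supp[of z] by simp
      then show "z \<in> frontier {x. \<phi> x \<le> 1}" by (rule finsler_unit_sphere_frontier[OF fin])
    qed
    then show "w = q" using sc by (auto simp: strictly_convex_def)
  qed
  ultimately show ?thesis by blast
qed

section \<open>Second order contact at a boundary point\<close>

lemma C11_on_quadratic_remainder:
  fixes f :: "'a::real_normed_vector \<Rightarrow> 'b::real_normed_vector"
  assumes "C11_on U f" "open U" "x \<in> U"
  obtains D L r where "(f has_derivative D) (at x)" "L > 0" "r > 0"
    "\<And>h. norm h < r \<Longrightarrow> x + h \<in> U \<and> norm (f (x + h) - f x - D h) \<le> L * (norm h)\<^sup>2"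
proof -
  obtain f' :: "'a \<Rightarrow> 'a \<Rightarrow>\<^sub>L 'b" where
    f': "\<And>y. y \<in> U \<Longrightarrow> (f has_derivative blinfun_apply (f' y)) (at y)"
    and lip: "\<forall>y\<in>U. \<exists>r>0. \<exists>L. L-lipschitz_on (ball y r \<inter> U) f'"
    using assms(1) unfolding C11_on_def by blast
  obtain r1 L where r1: "r1 > 0" and L: "L-lipschitz_on (ball x r1 \<inter> U) f'"
    using lip assms(3) by blast
  obtain r2 where r2: "r2 > 0" "ball x r2 \<subseteq> U"
    using assms(2,3) openE by blast
  define r where "r = min r1 r2"
  have "x + h \<in> U \<and> norm (f (x + h) - f x - f' x h) \<le> (L + 1) * (norm h)\<^sup>2"
    if h: "norm h < r" for h
  proof
    have sub: "cball x (norm h) \<subseteq> ball x r1 \<inter> U"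
      using h r2(2) by (auto simp: r_def)
    then show "x + h \<in> U" by (auto simp: dist_norm subset_iff)
    have "norm (f (x + h) - f x - f' x (x + h - x)) \<le> norm (x + h - x) * (L * norm h)"
    proof (rule differentiable_bound_linearization[where S = "cball x (norm h)"])
      show "x + t *\<^sub>R (x + h - x) \<in> cball x (norm h)" if "t \<in> {0..1}" for t
        using that by (simp add: dist_norm mult_left_le_one_le)
      show "(f has_derivative blinfun_apply (f' y)) (at y within cball x (norm h))"
        if "y \<in> cball x (norm h)" for y
        using f' sub that has_derivative_at_withinI by blast
      show "onorm (blinfun_apply (f' y) - blinfun_apply (f' x)) \<le> L * norm h" if "y \<in> cball x (norm h)" for y
      proof -
        have "x \<in> cball x (norm h)" by simp
        then have "norm (f' y - f' x) \<le> L * dist y x"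
          using lipschitz_onD[OF L, of y x] subsetD[OF sub] that by (simp only: dist_norm)
        also have "\<dots> \<le> L * norm h"
          using that lipschitz_on_nonneg[OF L] by (intro mult_left_mono) (auto simp: dist_commute)
        finally show ?thesis by (simp add: norm_blinfun.rep_eq minus_blinfun.rep_eq fun_diff_def)
      qed
      show "x \<in> cball x (norm h)" by simp
    qed
    also have "\<dots> \<le> (L + 1) * (norm h)\<^sup>2"
      by (simp add: power2_eq_square algebra_simps)
    finally show "norm (f (x + h) - f x - f' x h) \<le> (L + 1) * (norm h)\<^sup>2" by simp
  qed
  moreover have "L + 1 > 0" using lipschitz_on_nonneg[OF L] by simp
  moreover have "r > 0" using r1 r2 by (simp add: r_def)
  ultimately show thesis using that[of "f' x" "L + 1" r] f'[OF assms(3)] by blast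
qed

text \<open>In a \<open>C\<^sup>1\<^sup>,\<^sup>1\<close> chart the set is \<open>{\<Phi>\<^sub>k \<ge> 0}\<close>. With \<open>a\<close> the gradient of \<open>\<Phi>\<^sub>k\<close> at the boundary point, an inner
  normal, \<open>\<Phi>\<^sub>k\<close> differs from its linear part \<open>a \<bullet> h\<close> by at most \<open>L |h|\<^sup>2\<close>. So near the point the set contains one
  paraboloid touching the hyperplane \<open>a \<bullet> h = 0\<close> and is contained in the reflected one. The first
  inclusion is an interior ball condition; the second identifies \<open>a\<close> as a normal.\<close>

lemma C11_boundary_between_paraboloids:
  fixes S :: "(real ^ 'n) set"
  assumes "C11_manifold_with_boundary S" "x \<in> S" "x \<in> frontier S"
  obtains a L r where "a \<noteq> 0" "L > 0" "r > 0"
    "\<And>h. norm h < r \<Longrightarrow> L * (norm h)\<^sup>2 \<le> a \<bullet> h \<Longrightarrow> x + h \<in> S"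
    "\<And>h. norm h < r \<Longrightarrow> x + h \<in> S \<Longrightarrow> - L * (norm h)\<^sup>2 \<le> a \<bullet> h"
proof -
  obtain U V and \<Phi> \<Psi> :: "real ^ 'n \<Rightarrow> real ^ 'n" and k where
    U: "open U" "x \<in> U" and V: "open V" and hom: "homeomorphism U V \<Phi> \<Psi>"
    and C11: "C11_on U \<Phi>" "C11_on V \<Psi>" and img: "\<Phi> ` (U \<inter> S) = V \<inter> {y. 0 \<le> y $ k}"
    using bspec[OF assms(1)[unfolded C11_manifold_with_boundary_def] assms(2)]
    by (elim exE conjE) (rule that)
  have \<Phi>V: "\<Phi> y \<in> V" if "y \<in> U" for y using hom that by (auto simp: homeomorphism_def)
  have \<Psi>\<Phi>: "\<Psi> (\<Phi> y) = y" if "y \<in> U" for y using hom that by (auto simp: homeomorphism_def)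
  have \<Phi>\<Psi>: "\<Phi> (\<Psi> y) = y" if "y \<in> V" for y using hom that by (auto simp: homeomorphism_def)
  have mem: "y \<in> S \<longleftrightarrow> 0 \<le> \<Phi> y $ k" if "y \<in> U" for y
  proof
    assume "y \<in> S" then show "0 \<le> \<Phi> y $ k" using img that by blast
  next
    assume "0 \<le> \<Phi> y $ k"
    then have "\<Phi> y \<in> \<Phi> ` (U \<inter> S)" using img \<Phi>V[OF that] by blast
    then show "y \<in> S" using \<Psi>\<Phi> that by (metis IntE imageE)
  qed
  obtain D L r where D: "(\<Phi> has_derivative D) (at x)" and Lr: "L > 0" "r > 0"
    and quad: "\<And>h. norm h < r \<Longrightarrow>
      x + h \<in> U \<and> norm (\<Phi> (x + h) - \<Phi> x - D h) \<le> L * (norm h)\<^sup>2"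
    using C11_on_quadratic_remainder[OF C11(1) U] by blast
  \<comment> \<open>A boundary point is mapped into the bounding hyperplane: otherwise it would be interior.\<close>
  have \<Phi>x: "\<Phi> x $ k = 0"
  proof (rule ccontr)
    assume "\<Phi> x $ k \<noteq> 0"
    with mem U(2) assms(2) have pos: "\<Phi> x $ k > 0" by force
    have "continuous_on U (\<lambda>y. \<Phi> y $ k)"
      using hom by (auto simp: homeomorphism_def intro: continuous_intros)
    then have "open ((\<lambda>y. \<Phi> y $ k) -` {0<..} \<inter> U)"
      using continuous_on_open_vimage[OF U(1)] open_greaterThan by blast
    moreover have "(\<lambda>y. \<Phi> y $ k) -` {0<..} \<inter> U \<subseteq> S" using mem by force
    moreover have "x \<in> (\<lambda>y. \<Phi> y $ k) -` {0<..} \<inter> U" using pos U(2) by simp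
    ultimately have "x \<in> interior S" using interior_maximal by blast
    then show False using assms(3) by (simp add: frontier_def)
  qed
  have lin: "linear D" using D by (rule has_derivative_linear)
  define a where "a = adjoint D (axis k 1)"
  have a: "a \<bullet> h = D h $ k" for h
    using adjoint_works[OF lin, of h "axis k 1"] by (simp add: a_def inner_axis inner_commute)
  \<comment> \<open>The differential of \<open>\<Phi>\<close> is onto, because \<open>\<Psi>\<close> is a differentiable right inverse.\<close>
  have "a \<noteq> 0"
  proof -
    obtain B where B: "(\<Psi> has_derivative B) (at (\<Phi> x))"
      using C11_on_quadratic_remainder[OF C11(2) V \<Phi>V[OF U(2)]] by blast
    have "(\<Phi> has_derivative D) (at (\<Psi> (\<Phi> x)))" using D \<Psi>\<Phi>[OF U(2)] by simp
    from has_derivative_compose[OF B this]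
    have "((\<lambda>y. y) has_derivative (\<lambda>h. D (B h))) (at (\<Phi> x))"
      by (rule has_derivative_transform_within_open[OF _ V \<Phi>V[OF U(2)]]) (rule \<Phi>\<Psi>)
    then have "(\<lambda>h. D (B h)) = (\<lambda>h. h)"
      using has_derivative_unique has_derivative_ident by blast
    then have "a \<bullet> B (axis k 1) = 1" using a by (metis axis_nth)
    then show ?thesis by auto
  qed
  have approx: "\<bar>\<Phi> (x + h) $ k - a \<bullet> h\<bar> \<le> L * (norm h)\<^sup>2" if "norm h < r" for h
  proof -
    have "\<bar>(\<Phi> (x + h) - \<Phi> x - D h) $ k\<bar> \<le> L * (norm h)\<^sup>2"
      using component_le_norm_cart quad[OF that] order_trans by blast
    then show ?thesis by (simp add: \<Phi>x a)
  qed
  show thesis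
  proof (rule that[OF \<open>a \<noteq> 0\<close> Lr])
    show "x + h \<in> S" if "norm h < r" "L * (norm h)\<^sup>2 \<le> a \<bullet> h" for h
      using that mem[of "x + h"] quad[of h] approx[of h] by linarith
    show "- L * (norm h)\<^sup>2 \<le> a \<bullet> h" if "norm h < r" "x + h \<in> S" for h
      using that mem[of "x + h"] quad[of h] approx[of h] by force
  qed
qed

text \<open>The unit ball contains a paraboloid tangent at \<open>q\<close> to the hyperplane \<open>p \<bullet> h = 0\<close>. For tangential \<open>h\<close>
  the point \<open>q + h\<close> may lie outside the ball, but moving it inwards by \<open>s q\<close> with \<open>s\<close> of order
  \<open>|h|\<^sup>2\<close> brings it into the paraboloid, and subadditivity bounds the cost of this by
  \<open>\<phi>(s q) = s\<close>. Away from \<open>q\<close> the linear growth of \<open>\<phi>\<close> is dominated by a quadratic.\<close>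

lemma finsler_quadratic_contact:
  assumes fin: "finsler_norm \<phi>" and C11: "C11_manifold_with_boundary {x. \<phi> x \<le> 1}"
    and q: "\<phi> q = 1"
  obtains p C where "p \<bullet> q = 1" "\<And>z. p \<bullet> z \<le> \<phi> z" "C > 0"
    "\<And>h. p \<bullet> h = 0 \<Longrightarrow> \<phi> (q + h) \<le> 1 + C * (norm h)\<^sup>2"
proof -
  let ?S = "{x. \<phi> x \<le> 1}"
  have "q \<in> ?S" using q by simp
  then obtain a L r where "a \<noteq> 0" and L: "L > 0" and r: "r > 0"
    and inside: "\<And>h. norm h < r \<Longrightarrow> L * (norm h)\<^sup>2 \<le> a \<bullet> h \<Longrightarrow> \<phi> (q + h) \<le> 1"
    and normal: "\<And>h. norm h < r \<Longrightarrow> \<phi> (q + h) \<le> 1 \<Longrightarrow> - L * (norm h)\<^sup>2 \<le> a \<bullet> h"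
    using C11_boundary_between_paraboloids[OF C11 _ finsler_unit_sphere_frontier[OF fin q]]
    by (metis mem_Collect_eq)
  obtain M where M: "M > 0" "\<And>x. \<phi> x \<le> M * norm x"
    using finsler_norm_equiv[OF fin] by metis
  \<comment> \<open>The second-order error \<open>L |h|\<^sup>2\<close> disappears by convexity: moving from \<open>q\<close> a small fraction \<open>t\<close> of
      the way to \<open>z\<close> scales \<open>a \<bullet> h\<close> by \<open>t\<close> but the error by \<open>t\<^sup>2\<close>.\<close>
  have halfspace: "0 \<le> a \<bullet> (z - q)" if z: "\<phi> z \<le> 1" for z
  proof (rule ccontr)
    assume neg: "\<not> 0 \<le> a \<bullet> (z - q)"
    let ?v = "z - q"
    have v: "?v \<noteq> 0" using neg by auto
    \<comment> \<open>Small enough for the paraboloid to be valid, and for the error to be at most half of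
        \<open>- a \<bullet> (z - q)\<close> times \<open>t\<close>.\<close>
    define t where "t = min 1 (min (r / (2 * norm ?v)) (- (a \<bullet> ?v) / (2 * L * (norm ?v)\<^sup>2)))"
    have "0 < - (a \<bullet> ?v) / (2 * L * (norm ?v)\<^sup>2)" using v L neg by (intro divide_pos_pos) auto
    then have t: "0 < t" "t \<le> 1" using v r by (auto simp: t_def)
    have "t * norm ?v \<le> r / (2 * norm ?v) * norm ?v"
      by (intro mult_right_mono) (auto simp: t_def)
    also have "\<dots> < r" using r v by simp
    finally have small: "norm (t *\<^sub>R ?v) < r" using t by simp
    have "q + t *\<^sub>R ?v = (1 - t) *\<^sub>R q + t *\<^sub>R z" by (simp add: algebra_simps)
    moreover have "(1 - t) *\<^sub>R q + t *\<^sub>R z \<in> ?S"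
      using finsler_unit_ball_convex[OF fin] t z q unfolding convex_alt by auto
    ultimately have "- L * (norm (t *\<^sub>R ?v))\<^sup>2 \<le> a \<bullet> (t *\<^sub>R ?v)"
      using normal[OF small] by simp
    then have "t * (- (a \<bullet> ?v)) \<le> t * (t * (L * (norm ?v)\<^sup>2))"
      by (simp add: power_mult_distrib power2_eq_square mult_ac)
    then have 1: "- (a \<bullet> ?v) \<le> t * (L * (norm ?v)\<^sup>2)" using t(1) mult_le_cancel_left_pos by blast
    have "t * (L * (norm ?v)\<^sup>2) \<le> - (a \<bullet> ?v) / (2 * L * (norm ?v)\<^sup>2) * (L * (norm ?v)\<^sup>2)"
      using L by (intro mult_right_mono) (auto simp: t_def)
    also have "\<dots> = - (a \<bullet> ?v) / 2" using L v by simp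
    finally show False using 1 neg by linarith
  qed
  define b where "b = - (a \<bullet> q)"
  \<comment> \<open>The origin is interior to the ball, so a small multiple of \<open>- a\<close> can be tested in \<open>halfspace\<close>.\<close>
  have b: "b > 0"
  proof -
    define e where "e = 1 / (M * norm a)"
    have e: "e > 0" using M \<open>a \<noteq> 0\<close> by (simp add: e_def)
    have "\<phi> (- e *\<^sub>R a) \<le> M * (e * norm a)" using M(2)[of "- e *\<^sub>R a"] e by simp
    also have "\<dots> = 1" using M \<open>a \<noteq> 0\<close> by (simp add: e_def)
    finally have "e * (a \<bullet> a) \<le> b"
      using halfspace[of "- e *\<^sub>R a"] by (simp add: b_def inner_diff_right)
    moreover have "e * (a \<bullet> a) > 0" using e \<open>a \<noteq> 0\<close> by simp
    ultimately show ?thesis by linarith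
  qed
  define p where "p = (- 1 / b) *\<^sub>R a"
  have pq: "p \<bullet> q = 1" using b by (simp add: p_def b_def)
  have pz: "p \<bullet> z \<le> \<phi> z" for z
  proof (cases "z = 0")
    case False
    then have "\<phi> z > 0" using finsler_pos[OF fin] by simp
    then have "\<phi> ((1 / \<phi> z) *\<^sub>R z) = 1" using finsler_scale[OF fin] by simp
    then have "- b \<le> (a \<bullet> z) / \<phi> z"
      using halfspace[of "(1 / \<phi> z) *\<^sub>R z"] by (simp add: inner_diff_right b_def)
    then show ?thesis using b \<open>\<phi> z > 0\<close> by (simp add: p_def field_simps)
  qed (simp add: finsler_zero[OF fin])
  \<comment> \<open>The choice of \<open>\<rho>\<close> makes the inward shift \<open>s q\<close> no longer than \<open>h\<close>, so the shifted vector has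
      norm at most \<open>2 |h|\<close>. As \<open>a \<bullet> h = 0\<close>, the shift contributes \<open>s b = K b |h|\<^sup>2\<close> in the direction
      of \<open>a\<close>, which has to beat \<open>L (2 |h|)\<^sup>2\<close>.\<close>
  define K where "K = 4 * L / b"
  define \<rho> where "\<rho> = min (r / 3) (1 / (K * norm q))"
  have K: "K > 0" using L b by (simp add: K_def)
  have q0: "q \<noteq> 0" using q finsler_zero[OF fin] by force
  have \<rho>: "\<rho> > 0" using r K q0 by (simp add: \<rho>_def)
  have near: "\<phi> (q + h) \<le> 1 + K * (norm h)\<^sup>2" if ph: "p \<bullet> h = 0" and h: "norm h < \<rho>" for h
  proof -
    define s where "s = K * (norm h)\<^sup>2"
    define h' where "h' = h - s *\<^sub>R q"
    have s: "s \<ge> 0" using K by (simp add: s_def)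
    have "norm h * (K * norm q) \<le> 1"
      using h K q0 by (simp add: \<rho>_def field_simps)
    then have "norm h * (norm h * (K * norm q)) \<le> norm h * 1"
      by (intro mult_left_mono) auto
    then have "norm (s *\<^sub>R q) \<le> norm h" using s by (simp add: s_def power2_eq_square mult_ac)
    then have h'2: "norm h' \<le> 2 * norm h"
      unfolding h'_def using norm_triangle_ineq4[of h "s *\<^sub>R q"] by linarith
    then have "norm h' < r" using h r by (simp add: \<rho>_def)
    moreover have "L * (norm h')\<^sup>2 \<le> a \<bullet> h'"
    proof -
      have "L * (norm h')\<^sup>2 \<le> L * (2 * norm h)\<^sup>2"
        using L h'2 by (intro mult_left_mono power_mono) auto
      also have "\<dots> = s * b" using b by (simp add: s_def K_def power_mult_distrib)
      also have "\<dots> = a \<bullet> h'"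
        using ph b by (simp add: h'_def b_def p_def inner_diff_right)
      finally show ?thesis .
    qed
    ultimately have 1: "\<phi> (q + h') \<le> 1" by (rule inside)
    have "\<phi> (s *\<^sub>R q) = s"
      using s finsler_scale[OF fin, of s q] q finsler_zero[OF fin] by (cases "s = 0") auto
    moreover have qh: "(q + h') + s *\<^sub>R q = q + h" by (simp add: h'_def)
    ultimately have "\<phi> (q + h) \<le> 1 + s"
      using finsler_add_le[OF fin, of "q + h'" "s *\<^sub>R q", unfolded qh] 1 by linarith
    then show ?thesis by (simp add: s_def)
  qed
  have far: "\<phi> (q + h) \<le> 1 + M / \<rho> * (norm h)\<^sup>2" if "norm h \<ge> \<rho>" for h
  proof -
    have "\<phi> (q + h) \<le> 1 + M * norm h"
      using finsler_add_le[OF fin, of q h] M(2)[of h] q by linarith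
    moreover have "M * norm h * 1 \<le> M * norm h * (norm h / \<rho>)"
      using that \<rho> M by (intro mult_left_mono) auto
    ultimately show ?thesis by (simp add: power2_eq_square)
  qed
  show thesis
  proof (rule that[OF pq pz, of "max K (M / \<rho>)"])
    show "max K (M / \<rho>) > 0" using K by simp
    show "\<phi> (q + h) \<le> 1 + max K (M / \<rho>) * (norm h)\<^sup>2" if "p \<bullet> h = 0" for h
    proof -
      have "K * (norm h)\<^sup>2 \<le> max K (M / \<rho>) * (norm h)\<^sup>2"
        "M / \<rho> * (norm h)\<^sup>2 \<le> max K (M / \<rho>) * (norm h)\<^sup>2"
        by (intro mult_right_mono; simp)+
      then show ?thesis using near[OF that] far[of h] by (cases "norm h < \<rho>") force+
    qed
  qed
qed

text \<open>Both sides are one-homogeneous, so it suffices to compare them on the hyperplane \<open>p \<bullet> z = 1\<close>.\<close>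

lemma finsler_le_paraboloid_gauge:
  assumes fin: "finsler_norm \<phi>" and pq: "p \<bullet> q = 1"
    and contact: "\<And>h. p \<bullet> h = 0 \<Longrightarrow> \<phi> (q + h) \<le> 1 + C * (norm h)\<^sup>2"
    and y: "0 < p \<bullet> y"
  shows "\<phi> y \<le> paraboloid_gauge p q C y"
proof -
  let ?k = "p \<bullet> y"
  define h where "h = (1 / ?k) *\<^sub>R transverse p q y"
  have "p \<bullet> h = 0" using pq by (simp add: h_def transverse_def inner_diff_right)
  have "y = ?k *\<^sub>R (q + h)"
    using y by (simp add: h_def transverse_def scaleR_add_right)
  then have "\<phi> y = ?k * \<phi> (q + h)" using finsler_scale[OF fin y] by metis
  also have "\<dots> \<le> ?k * (1 + C * (norm h)\<^sup>2)"
    using contact[OF \<open>p \<bullet> h = 0\<close>] y by (intro mult_left_mono) auto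
  also have "\<dots> = paraboloid_gauge p q C y"
    using y by (simp add: paraboloid_gauge_def h_def power_mult_distrib field_simps
        power2_eq_square)
  finally show ?thesis .
qed

section \<open>The touching family\<close>

theorem proposition2:
  fixes \<phi> :: "real ^ 'n \<Rightarrow> real"
  assumes "finsler_norm \<phi>"
    and "C11_manifold_with_boundary {x. \<phi> x \<le> 1}"
    and "strictly_convex {x. \<phi> x \<le> 1}"
  shows "\<exists>\<psi> :: real ^ 'n \<Rightarrow> real ^ 'n \<Rightarrow> ennreal. \<forall>x. x \<noteq> 0 \<longrightarrow>
    convex_extended (\<psi> x) \<and> pos_one_homogeneous (\<psi> x) \<and>
    (\<exists>U. open U \<and> x \<in> U \<and> (\<forall>y\<in>U. \<psi> x y < \<infinity>) \<and> smooth_on U (\<lambda>y. enn2real (\<psi> x y))) \<and>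
    (\<forall>y. ennreal (\<phi> y) \<le> \<psi> x y) \<and> ennreal (\<phi> x) = \<psi> x x \<and>
    G_lower \<phi> (gradient (\<lambda>y. enn2real (\<psi> x y)) x) (hessian (\<lambda>y. enn2real (\<psi> x y)) x) = 0 \<and>
    G_upper \<phi> (gradient (\<lambda>y. enn2real (\<psi> x y)) x) (hessian (\<lambda>y. enn2real (\<psi> x y)) x) = 0"
proof (rule choice, rule allI)
  fix x :: "real ^ 'n"
  show "\<exists>\<psi> :: real ^ 'n \<Rightarrow> ennreal. x \<noteq> 0 \<longrightarrow>
    convex_extended \<psi> \<and> pos_one_homogeneous \<psi> \<and>
    (\<exists>U. open U \<and> x \<in> U \<and> (\<forall>y\<in>U. \<psi> y < \<infinity>) \<and> smooth_on U (\<lambda>y. enn2real (\<psi> y))) \<and>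
    (\<forall>y. ennreal (\<phi> y) \<le> \<psi> y) \<and> ennreal (\<phi> x) = \<psi> x \<and>
    G_lower \<phi> (gradient (\<lambda>y. enn2real (\<psi> y)) x) (hessian (\<lambda>y. enn2real (\<psi> y)) x) = 0 \<and>
    G_upper \<phi> (gradient (\<lambda>y. enn2real (\<psi> y)) x) (hessian (\<lambda>y. enn2real (\<psi> y)) x) = 0"
  proof (cases "x = 0")
    case False
    define k where "k = \<phi> x"
    define q where "q = (1 / k) *\<^sub>R x"
    have k: "k > 0" using finsler_pos[OF assms(1) False] by (simp add: k_def)
    have x: "x = k *\<^sub>R q" using k by (simp add: q_def)
    have q1: "\<phi> q = 1"
      using finsler_scale[OF assms(1), of "1 / k" x] k by (simp add: q_def k_def)
    obtain p C where pq: "p \<bullet> q = 1" and supp: "\<And>z. p \<bullet> z \<le> \<phi> z" and C: "C > 0"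
      and contact: "\<And>h. p \<bullet> h = 0 \<Longrightarrow> \<phi> (q + h) \<le> 1 + C * (norm h)\<^sup>2"
      using finsler_quadratic_contact[OF assms(1,2) q1] by blast
    let ?g = "paraboloid_gauge p q C" and ?H = "{y. 0 < p \<bullet> y}"
    define \<psi> where "\<psi> y = (if 0 < p \<bullet> y then ennreal (?g y) else \<infinity>)" for y
    have H: "open ?H" using open_halfspace_gt[of 0 p] by simp
    have xH: "x \<in> ?H" using pq k by (simp add: x)
    have g0: "0 \<le> ?g y" if "y \<in> ?H" for y
      using that C by (simp add: paraboloid_gauge_def)
    have fin: "{y. \<psi> y < \<infinity>} = ?H" by (auto simp: \<psi>_def)
    have real: "enn2real (\<psi> y) = ?g y" if "y \<in> ?H" for y
      using that g0[OF that] by (simp add: \<psi>_def)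
    \<comment> \<open>The values of \<open>enn2real \<circ> \<psi>\<close> and \<open>?g\<close> agree on the open half-space, which is enough for
        derivatives at \<open>x\<close>.\<close>
    have pd: "partial_deriv i (\<lambda>y. enn2real (\<psi> y)) y = partial_deriv i ?g y"
      if "y \<in> ?H" for i y
      using H that real by (rule partial_deriv_cong_open)
    have "gradient (\<lambda>y. enn2real (\<psi> y)) x = gradient ?g x"
      using pd xH by (simp add: gradient_def)
    then have grad: "gradient (\<lambda>y. enn2real (\<psi> y)) x = p"
      using gradient_paraboloid_gauge[OF pq k] x by simp
    have "hessian (\<lambda>y. enn2real (\<psi> y)) x = hessian ?g x"
      unfolding hessian_def by (intro Cart_lambda_cong partial_deriv_cong_open[OF H xH] pd)
    then have hess: "hessian (\<lambda>y. enn2real (\<psi> y)) x *v q = 0"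
      using hessian_paraboloid_gauge_radial[OF pq k] x by simp
    have sub: "subdifferential (dual_norm \<phi>) p = {q}"
      by (rule subdifferential_dual_norm_eq[OF assms(1,3) q1 pq supp])
    have g_convex: "convex_on ?H ?g"
      by (rule paraboloid_gauge_convex) (use C in simp)
    have "convex_on ?H (\<lambda>y. enn2real (\<psi> y))"
    proof (rule convex_onI)
      show "convex ?H" using g_convex by (rule convex_on_imp_convex)
      show "enn2real (\<psi> ((1 - t) *\<^sub>R y + t *\<^sub>R z)) \<le> (1 - t) * enn2real (\<psi> y) + t * enn2real (\<psi> z)"
        if "0 < t" "t < 1" "y \<in> ?H" "z \<in> ?H" for t y z
      proof -
        have "(1 - t) *\<^sub>R y + t *\<^sub>R z \<in> ?H"
          using convexD_alt[OF convex_on_imp_convex[OF g_convex] that(3,4)] that(1,2) by simp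
        then show ?thesis
          using convex_onD[OF g_convex, of t y z] that real by simp
      qed
    qed
    then have "convex_extended \<psi>"
      unfolding convex_extended_def fin by (auto intro: convex_on_imp_convex)
    moreover have "pos_one_homogeneous \<psi>"
      unfolding pos_one_homogeneous_def
    proof (intro allI impI)
      fix y and l :: real assume l: "l > 0"
      show "\<psi> (l *\<^sub>R y) = ennreal l * \<psi> y"
        using l g0[of y]
        by (auto simp: \<psi>_def paraboloid_gauge_homogeneous ennreal_mult zero_less_mult_iff
            ennreal_mult_top)
    qed
    moreover have "smooth_on ?H (\<lambda>y. enn2real (\<psi> y))"
      using paraboloid_gauge_smooth[of p q C] Ck_on_cong_open[OF H real]
      by (simp add: smooth_on_def)
    moreover have "ennreal (\<phi> y) \<le> \<psi> y" for y
      using finsler_le_paraboloid_gauge[OF assms(1) pq contact]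
      by (simp add: \<psi>_def ennreal_leI)
    moreover have "ennreal (\<phi> x) = \<psi> x"
    proof -
      have "?g x = k"
        using transverse_ray[OF pq] pq by (simp add: paraboloid_gauge_def x)
      then show ?thesis using xH by (simp add: \<psi>_def k_def)
    qed
    ultimately show ?thesis
      using H xH fin
      by (intro exI[of _ \<psi>]) (auto simp: grad G_lower_def G_upper_def sub hess intro!: exI[of _ ?H])
  qed simp
qed

end
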